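(* Let $\lambda=(\lambda_1,\dots,\lambda_t)\vdash k$ be a fixed partition and let $n\ge \lambda_1$ be an integer. Then $$s_{(n,\lambda)}=\sum_{j=0}^t (-1)^j\, s_{n+j}\, s_{\lambda/(1^j)}.$$
   Context: Here $\lambda_1\ge\dots\ge\lambda_t\ge 1$ are the (positive) parts of $\lambda$, with $\lambda_1+\dots+\lambda_t=k$, so $t$ is the number of parts. $(n,\lambda):=(n,\lambda_1,\dots,\lambda_t)$, a partition of $n+k$. $(1^j)$ denotes the partition with $j$ parts all equal to $1$ (the empty partition for $j=0$). $s_\mu$ denotes the Schur function indexed by a partition $\mu$, $s_{\lambda/\mu}$ the skew Schur function indexed by the skew shape $\lambda/\mu$, and $s_{m}=s_{(m)}$ is the Schur function of the one-row partition $(m)$, which equals the complete homogeneous symmetric function $h_m$. The identity holds in the ring of symmetric functions. *)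

theory Defs
  imports Complex_Main "HOL-Library.Multiset" "HOL-Library.FuncSet"
begin

section \<open>Formal power series in the variables $x_0, x_1, x_2, \ldots$\<close>

text \<open>
  A monomial $x_0^{a_0} x_1^{a_1} \cdots$ of finite degree is the multiset that contains
  the index $i$ exactly $a_i$ times; multiplication of monomials is addition of multisets.
  A formal power series is its coefficient function, so that series of unbounded degree
  are included. The ring of symmetric functions is a subring.
\<close>

typedef 'a mfps = "UNIV :: (nat multiset \<Rightarrow> 'a) set"
  morphisms mcoeff Abs_mfps ..

lemma mcoeff_Abs_mfps [simp]: "mcoeff (Abs_mfps f) = f"
  by (simp add: Abs_mfps_inverse)

lemma mfps_eqI: "(\<And>M. mcoeff f M = mcoeff g M) \<Longrightarrow> f = g"
  by (metis ext mcoeff_inject)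

lemma finite_submultisets: "finite {A. A \<subseteq># (M :: 'b multiset)}"
proof (induction M)
  case empty
  then show ?case by simp
next
  case (add x M)
  have "{A. A \<subseteq># add_mset x M} \<subseteq> {A. A \<subseteq># M} \<union> add_mset x ` {A. A \<subseteq># M}"
  proof
    fix A assume "A \<in> {A. A \<subseteq># add_mset x M}"
    then have A: "A \<subseteq># add_mset x M" by simp
    show "A \<in> {A. A \<subseteq># M} \<union> add_mset x ` {A. A \<subseteq># M}"
    proof (cases "x \<in># A")
      case True
      then obtain B where "A = add_mset x B" by (metis multi_member_split)
      with A show ?thesis by simp
    next
      case False
      have "count A y \<le> count M y" for y
        using A False mset_subset_eq_count[OF A, of y]
        by (cases "y = x") (auto simp: not_in_iff)
      then show ?thesis by (simp add: mset_subset_eqI)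
    qed
  qed
  then show ?case using add.IH by (meson finite_Un finite_imageI finite_subset)
qed

instantiation mfps :: (comm_ring_1) comm_ring_1
begin

definition zero_mfps :: "'a mfps" where
  "0 = Abs_mfps (\<lambda>_. 0)"

definition one_mfps :: "'a mfps" where
  "1 = Abs_mfps (\<lambda>M. if M = {#} then 1 else 0)"

definition plus_mfps :: "'a mfps \<Rightarrow> 'a mfps \<Rightarrow> 'a mfps" where
  "f + g = Abs_mfps (\<lambda>M. mcoeff f M + mcoeff g M)"

definition uminus_mfps :: "'a mfps \<Rightarrow> 'a mfps" where
  "- f = Abs_mfps (\<lambda>M. - mcoeff f M)"

definition minus_mfps :: "'a mfps \<Rightarrow> 'a mfps \<Rightarrow> 'a mfps" where
  "f - g = Abs_mfps (\<lambda>M. mcoeff f M - mcoeff g M)"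

definition times_mfps :: "'a mfps \<Rightarrow> 'a mfps \<Rightarrow> 'a mfps" where
  "f * g = Abs_mfps (\<lambda>M. \<Sum>A | A \<subseteq># M. mcoeff f A * mcoeff g (M - A))"

instance
proof
  fix a b c :: "'a mfps"
  show "a + b + c = a + (b + c)" "a + b = b + a" "0 + a = a" "- a + a = 0" "a - b = a + - b"
    by (auto simp: plus_mfps_def zero_mfps_def uminus_mfps_def minus_mfps_def
        algebra_simps intro!: mfps_eqI)
  show "(0::'a mfps) \<noteq> 1"
  proof
    assume "(0::'a mfps) = 1"
    then have "mcoeff (0::'a mfps) {#} = mcoeff 1 {#}" by simp
    then show False by (simp add: zero_mfps_def one_mfps_def)
  qed
  show "(a + b) * c = a * c + b * c"
    by (auto simp: plus_mfps_def times_mfps_def algebra_simps sum.distrib intro!: mfps_eqI)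
  show "1 * a = a"
  proof (rule mfps_eqI)
    fix M
    have "mcoeff (1 * a) M = (\<Sum>A | A \<subseteq># M. if A = {#} then mcoeff a M else 0)"
      by (auto simp: times_mfps_def one_mfps_def intro!: sum.cong)
    also have "\<dots> = mcoeff a M"
      using finite_submultisets[of M] by (simp add: sum.delta)
    finally show "mcoeff (1 * a) M = mcoeff a M" .
  qed
  show "a * b = b * a"
  proof (rule mfps_eqI)
    fix M
    have "(\<Sum>A | A \<subseteq># M. mcoeff a A * mcoeff b (M - A))
        = (\<Sum>A | A \<subseteq># M. mcoeff b A * mcoeff a (M - A))"
      by (rule sum.reindex_bij_witness[where i = "\<lambda>A. M - A" and j = "\<lambda>A. M - A"])
         (auto simp: double_diff mult.commute subset_mset.diff_diff_right)
    then show "mcoeff (a * b) M = mcoeff (b * a) M" by (simp add: times_mfps_def)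
  qed
  show "a * b * c = a * (b * c)"
  proof (rule mfps_eqI)
    fix M
    have "(\<Sum>A | A \<subseteq># M. (\<Sum>B | B \<subseteq># A. mcoeff a B * mcoeff b (A - B)) * mcoeff c (M - A))
        = (\<Sum>(A, B) \<in> (SIGMA A:{A. A \<subseteq># M}. {B. B \<subseteq># A}).
             mcoeff a B * mcoeff b (A - B) * mcoeff c (M - A))"
      by (simp add: sum_distrib_right sum.Sigma finite_submultisets)
    also have "\<dots> = (\<Sum>(B, C) \<in> (SIGMA B:{B. B \<subseteq># M}. {C. C \<subseteq># M - B}).
             mcoeff a B * (mcoeff b C * mcoeff c (M - B - C)))"
    proof (rule sum.reindex_bij_witness
        [where i = "\<lambda>(B, C). (B + C, B)" and j = "\<lambda>(A, B). (B, A - B)"], goal_cases)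
      case (1 x)
      then show ?case by (auto simp: subset_mset.add_diff_inverse)
    next
      case (2 x)
      then obtain A B where "x = (A, B)" "A \<subseteq># M" "B \<subseteq># A" by auto
      moreover from this have "B \<subseteq># M" by (meson subset_mset.order_trans)
      ultimately show ?case by (auto simp: subseteq_mset_def diff_le_mono)
    next
      case (3 x)
      then show ?case by auto
    next
      case (4 x)
      then obtain B C where "x = (B, C)" "B \<subseteq># M" "C \<subseteq># M - B" by auto
      moreover from this have "B + C \<subseteq># M"
        by (metis subset_mset.add_left_mono subset_mset.add_diff_inverse)
      ultimately show ?case by auto
    next
      case (5 x)
      then obtain A B where x: "x = (A, B)" "A \<subseteq># M" "B \<subseteq># A" by auto
      then have "M - B - (A - B) = M - A"
        by (metis diff_diff_add_mset subset_mset.add_diff_inverse)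
      with x show ?case by (simp add: mult.assoc)
    qed
    also have "\<dots> = (\<Sum>B | B \<subseteq># M. mcoeff a B * (\<Sum>C | C \<subseteq># M - B. mcoeff b C * mcoeff c (M - B - C)))"
      by (simp add: sum_distrib_left sum.Sigma finite_submultisets)
    finally show "mcoeff (a * b * c) M = mcoeff (a * (b * c)) M" by (simp add: times_mfps_def)
  qed
qed

end


section \<open>Partitions, tableaux and Schur functions\<close>

text \<open>Only the positive parts of a partition are listed.\<close>

definition is_partition :: "nat list \<Rightarrow> nat \<Rightarrow> bool" where
  "is_partition lam k \<longleftrightarrow> sorted_wrt (\<ge>) lam \<and> 0 \<notin> set lam \<and> sum_list lam = k"

definition part :: "nat list \<Rightarrow> nat \<Rightarrow> nat" where
  "part lam i = (if i < length lam then lam ! i else 0)"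

text \<open>
  Cells are pairs (row, column), both counted from 0, in English notation. A trailing
  part 0 in the list does not affect the diagram.
\<close>

definition skew_diagram :: "nat list \<Rightarrow> nat list \<Rightarrow> (nat \<times> nat) set" where
  "skew_diagram lam mu = {(i, j). part mu i \<le> j \<and> j < part lam i}"

text \<open>
  A filling is extensional (constantly \<^term>\<open>undefined\<close> outside the diagram), so distinct
  functions are distinct tableaux. The entry $v$ stands for the variable $x_v$.
\<close>

definition ssyt :: "(nat \<times> nat) set \<Rightarrow> (nat \<times> nat \<Rightarrow> nat) set" where
  "ssyt D = {T \<in> D \<rightarrow>\<^sub>E UNIV.
     (\<forall>i j. (i, j) \<in> D \<and> (i, Suc j) \<in> D \<longrightarrow> T (i, j) \<le> T (i, Suc j)) \<and>
     (\<forall>i j. (i, j) \<in> D \<and> (Suc i, j) \<in> D \<longrightarrow> T (i, j) < T (Suc i, j))}"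

definition tableau_monomial :: "(nat \<times> nat) set \<Rightarrow> (nat \<times> nat \<Rightarrow> nat) \<Rightarrow> nat multiset" where
  "tableau_monomial D T = image_mset T (mset_set D)"

text \<open>
  The skew Schur function $s_{\lambda/\mu} = \sum_T x^T$ over the semistandard tableaux of shape $\lambda/\mu$, for
  partitions $\mu \subseteq \lambda$.
\<close>

definition skew_schur :: "nat list \<Rightarrow> nat list \<Rightarrow> int mfps" where
  "skew_schur lam mu = Abs_mfps (\<lambda>M. int (card
     {T \<in> ssyt (skew_diagram lam mu). tableau_monomial (skew_diagram lam mu) T = M}))"

definition schur :: "nat list \<Rightarrow> int mfps" where
  "schur lam = skew_schur lam []"

lemma finite_skew_diagram: "finite (skew_diagram lam mu)"
proof (rule finite_subset)
  show "skew_diagram lam mu \<subseteq> (SIGMA i:{..<length lam}. {..<lam ! i})"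
    by (auto simp: skew_diagram_def part_def split: if_splits)
qed auto

text \<open>The cardinality in the definition of \<^const>\<open>skew_schur\<close> is that of a finite set.\<close>

lemma finite_ssyt_monomial:
  assumes "finite D"
  shows "finite {T \<in> ssyt D. tableau_monomial D T = M}"
proof (rule finite_subset)
  show "{T \<in> ssyt D. tableau_monomial D T = M} \<subseteq> D \<rightarrow>\<^sub>E set_mset M"
    using assms by (auto simp: ssyt_def tableau_monomial_def PiE_def)
  show "finite (D \<rightarrow>\<^sub>E set_mset M)"
    using assms by (simp add: finite_PiE)
qed

end

theory Submission imports Defs begin

text \<open>
  The product $s_{n+j}\, s_{\lambda/(1^j)}$ counts pairs $(R, T)$ of a row $R$ of length $n+j$
  and a tableau $T$ of shape $\lambda/(1^j)$. Read every row as a lattice path whose $c$-th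
  horizontal step has the entry in column $c$ as its height. With the sources and sinks of the
  shape $(n, \lambda)$, the semistandard tableaux of that shape are the families of pairwise
  disjoint paths, from the source $a_i$ to the sink $b_i$ for $i = 0, \ldots, t$. In a pair
  $(R, T)$ the path of $R$ leads from $a_j$ to the sink $b_0$ of the top row, while the paths of
  the rows of $T$ lead from the remaining sources to the remaining sinks and are disjoint from
  each other, but possibly not from $R$.

  Follow $R$ from its source to the first point that it shares with a path of $T$. The source of
  $R$ lies between those of the rows $j-1$ and $j$ of $T$ (rows counted from 0), so the path met
  first is one of these two. Exchanging the initial segments of the two paths up to the meeting
  point leaves the paths of the new tableau pairwise disjoint, since the old segment of $R$ met
  none of them before. If row $j-1$ was met, then the result is a pair for $j-1$ whose row meets
  row $j-1$ first, now from the other side; and this exchange is invertible. The pairs for $j$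
  therefore split into those that meet the row above the source of $R$ (\<open>first_above\<close>) and those
  that meet the row below it (\<open>first_below\<close>), and the second kind for $j$ has the same generating
  function as the first kind for $j+1$ (\<open>card_first_above_eq_first_below\<close>), so that the alternating
  sum telescopes.

  At the two ends nothing is left to be exchanged. For $j = t$ there is no row below the source of
  $R$. For $j = 0$ there is no row above it, and the pairs without a meeting are the tableaux of
  shape $(n, \lambda)$ (\<open>card_stacked\<close>). For $0 < j$ a meeting always occurs, because
  $n \ge \lambda_1$ makes $R$ overtake the end of row $j-1$.
\<close>

type_synonym filling = "nat \<times> nat \<Rightarrow> nat"

section \<open>Coefficients of sums and products\<close>

lemma mcoeff_sum: "mcoeff (\<Sum>x\<in>A. f x) M = (\<Sum>x\<in>A. mcoeff (f x) M)"
  by (induction A rule: infinite_finite_induct) (simp_all add: zero_mfps_def plus_mfps_def)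

lemma mcoeff_minus_one_power_mult: "mcoeff ((- 1) ^ j * f) M = (- 1) ^ j * mcoeff f M"
  by (cases "even j") (simp_all, simp add: uminus_mfps_def)

definition pair_monomial ::
  "(nat \<times> nat) set \<Rightarrow> (nat \<times> nat) set \<Rightarrow> filling \<times> filling \<Rightarrow> nat multiset" where
  "pair_monomial D E p = tableau_monomial D (fst p) + tableau_monomial E (snd p)"

text \<open>
  The fibre of the monomial is split along the share of the first component, which is the index
  of summation in the product of power series.
\<close>

lemma pairs_of_monomial_eq_Union:
  "{p \<in> ssyt D \<times> ssyt E. pair_monomial D E p = M} =
     (\<Union>A\<in>{A. A \<subseteq># M}. {S \<in> ssyt D. tableau_monomial D S = A} \<times>
        {T \<in> ssyt E. tableau_monomial E T = M - A})"
  by (auto simp: pair_monomial_def)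

lemma finite_pairs_of_monomial:
  assumes "finite D" "finite E"
  shows "finite {p \<in> ssyt D \<times> ssyt E. pair_monomial D E p = M}"
  unfolding pairs_of_monomial_eq_Union
  using assms by (intro finite_UN_I finite_submultisets finite_cartesian_product finite_ssyt_monomial)

lemma mcoeff_skew_schur_mult:
  "mcoeff (skew_schur lam mu * skew_schur lam' mu') M =
     int (card {p \<in> ssyt (skew_diagram lam mu) \<times> ssyt (skew_diagram lam' mu').
       pair_monomial (skew_diagram lam mu) (skew_diagram lam' mu') p = M})"
  unfolding pairs_of_monomial_eq_Union
  by (subst card_UN_disjoint)
    (auto simp: finite_submultisets finite_ssyt_monomial finite_skew_diagram
      card_cartesian_product times_mfps_def skew_schur_def)

section \<open>Monomials under cutting and moving of cells\<close>

lemma tableau_monomial_Un_disjoint: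
  assumes "finite A" "finite B" "A \<inter> B = {}"
  shows "tableau_monomial (A \<union> B) T = tableau_monomial A T + tableau_monomial B T"
  using assms by (simp add: tableau_monomial_def mset_set_Union)

lemma tableau_monomial_reindex:
  assumes "bij_betw f A B" "\<And>a. a \<in> A \<Longrightarrow> S a = T (f a)"
  shows "tableau_monomial A S = tableau_monomial B T"
proof -
  have "image_mset S (mset_set A) = image_mset (\<lambda>a. T (f a)) (mset_set A)"
    using assms(2) by (cases "finite A") (auto intro!: image_mset_cong)
  also have "\<dots> = image_mset T (image_mset f (mset_set A))"
    by (simp add: image_mset.compositionality comp_def)
  also have "image_mset f (mset_set A) = mset_set B"
    using assms(1) by (auto simp: bij_betw_def image_mset_mset_set)
  finally show ?thesis by (simp add: tableau_monomial_def)
qed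

section \<open>Tableaux of the shapes that occur\<close>

lemma mem_ssyt_iff:
  "T \<in> ssyt D \<longleftrightarrow> T \<in> extensional D \<and>
     (\<forall>i j. (i, j) \<in> D \<and> (i, Suc j) \<in> D \<longrightarrow> T (i, j) \<le> T (i, Suc j)) \<and>
     (\<forall>i j. (i, j) \<in> D \<and> (Suc i, j) \<in> D \<longrightarrow> T (i, j) < T (Suc i, j))"
  by (auto simp: ssyt_def PiE_def)

lemma skew_diagram_row: "skew_diagram [m] [] = {0} \<times> {..<m}"
  by (auto simp: skew_diagram_def part_def split: if_splits)

definition cut_diagram :: "nat list \<Rightarrow> nat \<Rightarrow> (nat \<times> nat) set" where
  "cut_diagram lam j = skew_diagram lam (replicate j 1)"

lemma mem_cut_diagram_iff:
  "(r, c) \<in> cut_diagram lam j \<longleftrightarrow> (r < j \<longrightarrow> 0 < c) \<and> c < part lam r"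
  by (auto simp: cut_diagram_def skew_diagram_def part_def split: if_splits)

lemma finite_cut_diagram: "finite (cut_diagram lam j)"
  unfolding cut_diagram_def by (rule finite_skew_diagram)

lemma cut_diagram_0: "cut_diagram lam 0 = skew_diagram lam []"
  by (simp add: cut_diagram_def)

lemma mem_skew_diagram_empty: "(r, c) \<in> skew_diagram lam [] \<longleftrightarrow> c < part lam r"
  by (auto simp: skew_diagram_def part_def split: if_splits)

lemma part_antimono:
  assumes "is_partition lam k" "i \<le> j"
  shows "part lam j \<le> part lam i"
  using assms sorted_wrt_nth_less[of "(\<ge>)" lam i j]
  by (cases "i = j") (auto simp: part_def is_partition_def)

lemma ssyt_row_mono:
  assumes "R \<in> ssyt (skew_diagram [m] [])" "a \<le> b" "b < m"
  shows "R (0, a) \<le> R (0, b)"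
  using assms(2,3)
proof (induction b rule: dec_induct)
  case (step b)
  then have "R (0, b) \<le> R (0, Suc b)"
    using assms(1) by (simp add: mem_ssyt_iff skew_diagram_row)
  with step show ?case by simp
qed simp

section \<open>Exchanging initial segments\<close>

definition tableau_pairs :: "nat list \<Rightarrow> nat \<Rightarrow> nat \<Rightarrow> (filling \<times> filling) set" where
  "tableau_pairs lam n j =
     ssyt (skew_diagram [n + j] []) \<times> ssyt (cut_diagram lam j)"

text \<open>
  Pairs for \<open>i + 1\<close> whose row \<open>R\<close> meets row \<open>i\<close> of \<open>T\<close> first. On the vertical line that follows the
  step \<open>R (0, e)\<close>, the path of row \<open>i\<close> rises to the height \<open>T (i, e + 1)\<close> of its next step, so that \<open>R\<close>
  avoids row \<open>i\<close> there iff \<open>T (i, e + 1) < R (0, e)\<close>. On the vertical line that precedes this step, the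
  path of row \<open>i + 1\<close> arrives at the height \<open>T (i + 1, e)\<close>, so that \<open>R\<close> avoids row \<open>i + 1\<close> there iff
  \<open>R (0, e) < T (i + 1, e)\<close>. The range \<open>e \<le> d\<close> of the second condition covers just the vertical lines
  up to the one of the meeting. After its last step the path of row \<open>i\<close> rises without bound, which
  is why nothing is required of \<open>R (0, d)\<close> if \<open>d\<close> is the last column of that row.
\<close>

definition meets_above :: "nat list \<Rightarrow> nat \<Rightarrow> nat \<Rightarrow> nat \<Rightarrow> (filling \<times> filling) set" where
  "meets_above lam n i d = {(R, T) \<in> tableau_pairs lam n (Suc i).
     (Suc d < part lam i \<longrightarrow> R (0, d) \<le> T (i, Suc d)) \<and>
     (\<forall>e<d. T (i, Suc e) < R (0, e)) \<and>
     (\<forall>e\<le>d. e < part lam (Suc i) \<longrightarrow> R (0, e) < T (Suc i, e))}"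

text \<open>
  Pairs for \<open>i\<close> whose row \<open>R\<close> meets row \<open>i\<close> of \<open>T\<close> first; here row \<open>i\<close> is the one below the source of
  \<open>R\<close>, and row \<open>i - 1\<close> the one above it. The meeting takes place on the vertical line that precedes
  \<open>R (0, d)\<close>, the same on which \<open>R (0, d - 1)\<close> is compared with row \<open>i - 1\<close>. If \<open>R\<close> failed to avoid
  both rows on this line, then it would meet row \<open>i - 1\<close> before row \<open>i\<close>, because that row has the
  smaller entries. This is why row \<open>i - 1\<close> has to be avoided for all \<open>e < d\<close>.
\<close>

definition meets_below :: "nat list \<Rightarrow> nat \<Rightarrow> nat \<Rightarrow> nat \<Rightarrow> (filling \<times> filling) set" where
  "meets_below lam n i d = {(R, T) \<in> tableau_pairs lam n i.
     T (i, d) \<le> R (0, d) \<and>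
     (\<forall>e<d. R (0, e) < T (i, e)) \<and>
     (\<forall>h e. i = Suc h \<and> e < d \<longrightarrow> T (h, Suc e) < R (0, e))}"

text \<open>
  The exchange of initial segments: the first \<open>d + 1\<close> entries of \<open>R\<close> replace the \<open>d\<close> entries that
  row \<open>i\<close> of \<open>T\<close> has in the columns \<open>1, \<dots>, d\<close>. They fill the missing cell in column 0 as well, and \<open>R\<close>
  becomes shorter by one.
\<close>

definition pull_in :: "nat \<Rightarrow> nat \<Rightarrow> nat \<Rightarrow> filling \<times> filling \<Rightarrow> filling \<times> filling" where
  "pull_in n i d = (\<lambda>(R, T).
     (\<lambda>(r, c). if r = 0 \<and> c < n + i then (if c < d then T (i, Suc c) else R (0, Suc c)) else undefined,
      \<lambda>(r, c). if r = i \<and> c \<le> d then R (0, c) else T (r, c)))"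

definition push_out :: "nat \<Rightarrow> nat \<Rightarrow> nat \<Rightarrow> filling \<times> filling \<Rightarrow> filling \<times> filling" where
  "push_out n i d = (\<lambda>(R, T).
     (\<lambda>(r, c). if r = 0 \<and> c < Suc (n + i) then (if c \<le> d then T (i, c) else R (0, c - 1)) else undefined,
      \<lambda>(r, c). if r = i \<and> c \<le> d then (if c = 0 then undefined else R (0, c - 1)) else T (r, c)))"

lemma push_out_pull_in:
  assumes "p \<in> tableau_pairs lam n (Suc i)" "d < part lam i" "part lam i \<le> n"
  shows "push_out n i d (pull_in n i d p) = p"
  using assms
  by (cases p) (auto simp: push_out_def pull_in_def tableau_pairs_def mem_ssyt_iff extensional_def
      skew_diagram_row mem_cut_diagram_iff fun_eq_iff)

lemma pull_in_push_out:
  assumes "p \<in> tableau_pairs lam n i" "d < part lam i" "part lam i \<le> n"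
  shows "pull_in n i d (push_out n i d p) = p"
  using assms
  by (cases p) (auto simp: push_out_def pull_in_def tableau_pairs_def mem_ssyt_iff extensional_def
      skew_diagram_row mem_cut_diagram_iff fun_eq_iff)

text \<open>
  Both diagrams are cut along the two segments that change places; the exchange restricts to a
  bijection between the corresponding pieces.
\<close>

lemma pair_monomial_pull_in:
  assumes "d < part lam i" "part lam i \<le> n"
  shows "pair_monomial (skew_diagram [n + i] []) (cut_diagram lam i) (pull_in n i d p)
    = pair_monomial (skew_diagram [n + Suc i] []) (cut_diagram lam (Suc i)) p"
proof -
  obtain R T where p: "p = (R, T)" by force
  obtain R' T' where q: "pull_in n i d p = (R', T')" by force
  have R': "R' (0, c) = (if c < d then T (i, Suc c) else R (0, Suc c))" if "c < n + i" for c
    using q that by (auto simp: pull_in_def p)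
  have T': "T' (r, c) = (if r = i \<and> c \<le> d then R (0, c) else T (r, c))" for r c
    using q by (auto simp: pull_in_def p)
  define E where "E = cut_diagram lam i - {i} \<times> {..d}"
  have finE: "finite E" by (simp add: E_def finite_cut_diagram)
  have D: "cut_diagram lam i = {i} \<times> {..d} \<union> E"
    "cut_diagram lam (Suc i) = {i} \<times> {1..d} \<union> E"
    using assms by (auto simp: E_def mem_cut_diagram_iff)
  have rows: "skew_diagram [n + i] [] = {0} \<times> {..<d} \<union> {0} \<times> {d..<n + i}"
    "skew_diagram [n + Suc i] [] = {0} \<times> {..d} \<union> {0} \<times> {Suc d..<n + Suc i}"
    using assms by (auto simp: skew_diagram_row)
  have new: "pair_monomial (skew_diagram [n + i] []) (cut_diagram lam i) (R', T')
    = tableau_monomial ({0} \<times> {..<d}) R' + tableau_monomial ({0} \<times> {d..<n + i}) R'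
      + (tableau_monomial ({i} \<times> {..d}) T' + tableau_monomial E T')"
    unfolding pair_monomial_def D rows
    by (subst (1 2) tableau_monomial_Un_disjoint) (use finE in \<open>auto simp: E_def\<close>)
  have old: "pair_monomial (skew_diagram [n + Suc i] []) (cut_diagram lam (Suc i)) (R, T)
    = tableau_monomial ({0} \<times> {..d}) R + tableau_monomial ({0} \<times> {Suc d..<n + Suc i}) R
      + (tableau_monomial ({i} \<times> {1..d}) T + tableau_monomial E T)"
    unfolding pair_monomial_def D rows
    by (subst (1 2) tableau_monomial_Un_disjoint) (use finE in \<open>auto simp: E_def\<close>)
  have "tableau_monomial ({0} \<times> {..<d}) R' = tableau_monomial ({i} \<times> {1..d}) T"
    by (rule tableau_monomial_reindex[where f = "\<lambda>(r, c). (i, Suc c)"])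
      (use assms in \<open>auto simp: R' intro!: bij_betw_byWitness[where f' = "\<lambda>(r, c). (0, c - 1)"]\<close>)
  moreover have "tableau_monomial ({0} \<times> {d..<n + i}) R' = tableau_monomial ({0} \<times> {Suc d..<n + Suc i}) R"
    by (rule tableau_monomial_reindex[where f = "\<lambda>(r, c). (0, Suc c)"])
      (use assms in \<open>auto simp: R' intro!: bij_betw_byWitness[where f' = "\<lambda>(r, c). (0, c - 1)"]\<close>)
  moreover have "tableau_monomial ({i} \<times> {..d}) T' = tableau_monomial ({0} \<times> {..d}) R"
    by (rule tableau_monomial_reindex[where f = "\<lambda>(r, c). (0, c)"])
      (auto simp: T' intro!: bij_betw_byWitness[where f' = "\<lambda>(r, c). (i, c)"])
  moreover have "tableau_monomial E T' = tableau_monomial E T"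
    by (rule tableau_monomial_reindex[where f = id]) (auto simp: T' E_def split: if_splits)
  ultimately show ?thesis using new old by (simp only: q) (simp add: p)
qed

text \<open>
  The inequality at the meeting point lets the moved entries fit into row \<open>i\<close> on the left of its
  old tail. Row \<open>i\<close> exceeds row \<open>i - 1\<close> afterwards because the moved entries of \<open>R\<close> exceed the ones
  that they replace, \<open>R\<close> having avoided row \<open>i\<close> before \<open>d\<close>; it stays below row \<open>i + 1\<close> because \<open>R\<close>
  avoided that row up to \<open>d\<close>. The old column inequalities between the rows \<open>i - 1\<close> and \<open>i\<close> turn into
  the avoidance of row \<open>i - 1\<close> by the new row.
\<close>

lemma pull_in_meets_below:
  assumes "is_partition lam k" "part lam 0 \<le> n" "d < part lam i" "p \<in> meets_above lam n i d"
  shows "pull_in n i d p \<in> meets_below lam n i d"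
proof -
  obtain R T where p: "p = (R, T)" by force
  obtain R' T' where q: "pull_in n i d p = (R', T')" by force
  have R': "R' (0, c) = (if c < d then T (i, Suc c) else R (0, Suc c))" if "c < n + i" for c
    using q that by (auto simp: pull_in_def p)
  have T': "T' (r, c) = (if r = i \<and> c \<le> d then R (0, c) else T (r, c))" for r c
    using q by (auto simp: pull_in_def p)
  have anti: "part lam b \<le> part lam a" if "a \<le> b" for a b
    using part_antimono[OF assms(1) that] .
  have n: "part lam i \<le> n" using anti[of 0 i] assms(2) by simp
  have R: "R \<in> ssyt (skew_diagram [n + Suc i] [])"
    and T: "T \<in> ssyt (cut_diagram lam (Suc i))"
    and at: "Suc d < part lam i \<Longrightarrow> R (0, d) \<le> T (i, Suc d)"
    and before: "\<And>e. e < d \<Longrightarrow> T (i, Suc e) < R (0, e)"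
    and free: "\<And>e. e \<le> d \<Longrightarrow> e < part lam (Suc i) \<Longrightarrow> R (0, e) < T (Suc i, e)"
    using assms(4) by (auto simp: meets_above_def tableau_pairs_def p)
  have Rmono: "R (0, a) \<le> R (0, b)" if "a \<le> b" "b < n + Suc i" for a b
    using ssyt_row_mono[OF R that] .
  have Trow: "T (r, c) \<le> T (r, Suc c)" if "r < Suc i \<longrightarrow> 0 < c" "Suc c < part lam r" for r c
    using T that by (auto simp: mem_ssyt_iff mem_cut_diagram_iff)
  have Tcol: "T (r, c) < T (Suc r, c)" if "r < Suc i \<longrightarrow> 0 < c" "c < part lam (Suc r)" for r c
    using T that anti[of r "Suc r"]
    by (auto simp: mem_ssyt_iff mem_cut_diagram_iff)
  have "R' \<in> extensional (skew_diagram [n + i] [])"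
    using q by (auto simp: pull_in_def p skew_diagram_row extensional_def)
  moreover have "R' (0, c) \<le> R' (0, Suc c)" if "Suc c < n + i" for c
  proof -
    consider "Suc c < d" | "Suc c = d" | "d \<le> c" by linarith
    then show ?thesis
    proof cases
      case 1 then show ?thesis using Trow[of i "Suc c"] that assms(3) by (simp add: R')
    next
      case 2 then show ?thesis
        using before[of c] Rmono[of c "Suc (Suc c)"] that by (simp add: R')
    next
      case 3 then show ?thesis using Rmono[of "Suc c" "Suc (Suc c)"] that by (simp add: R')
    qed
  qed
  ultimately have R'_ssyt: "R' \<in> ssyt (skew_diagram [n + i] [])"
    by (auto simp: mem_ssyt_iff skew_diagram_row)
  have "T' \<in> extensional (cut_diagram lam i)"
    using T assms(3) by (auto simp: extensional_def mem_ssyt_iff mem_cut_diagram_iff T'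
       )
  moreover have "T' (r, c) \<le> T' (r, Suc c)" if "r < i \<longrightarrow> 0 < c" "Suc c < part lam r" for r c
  proof -
    consider "r \<noteq> i" | "r = i" "c < d" | "r = i" "c = d" | "r = i" "d < c" by linarith
    then show ?thesis
    proof cases
      case 1 then show ?thesis using Trow[of r c] that by (auto simp: T')
    next
      case 2 then show ?thesis using Rmono[of c "Suc c"] that n by (simp add: T')
    next
      case 3 then show ?thesis using at that by (simp add: T')
    next
      case 4 then show ?thesis using Trow[of r c] that by (simp add: T')
    qed
  qed
  moreover have "T' (r, c) < T' (Suc r, c)" if "r < i \<longrightarrow> 0 < c" "c < part lam (Suc r)" for r c
  proof -
    consider "r = i" "c \<le> d" | "Suc r = i" "c \<le> d" | "r \<noteq> i" "Suc r \<noteq> i" | "d < c" by linarith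
    then show ?thesis
    proof cases
      case 1 then show ?thesis using free that by (simp add: T')
    next
      case 2
      define c' where "c' = c - 1"
      have c: "c = Suc c'" using 2 that by (simp add: c'_def)
      with 2 show ?thesis
        using Tcol[of r c] that before[of c'] Rmono[of c' c] n by (simp add: T')
    next
      case 3 then show ?thesis using Tcol[of r c] that by (auto simp: T')
    next
      case 4 then show ?thesis using Tcol[of r c] that by (auto simp: T')
    qed
  qed
  ultimately have T'_ssyt: "T' \<in> ssyt (cut_diagram lam i)"
    by (auto simp: mem_ssyt_iff mem_cut_diagram_iff)
  have "T' (i, d) \<le> R' (0, d)"
    using Rmono[of d "Suc d"] assms(3) n by (simp add: T' R')
  moreover have "R' (0, e) < T' (i, e)" if "e < d" for e
    using before that assms(3) n by (simp add: T' R')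
  moreover have "T' (h, Suc e) < R' (0, e)" if "i = Suc h" "e < d" for h e
    using Tcol[of h "Suc e"] that assms(3) n by (simp add: T' R')
  ultimately show ?thesis
    using R'_ssyt T'_ssyt by (auto simp: q meets_below_def tableau_pairs_def)
qed

text \<open>
  The argument for the inverse exchange runs backwards: the avoidance of row \<open>i - 1\<close> now gives the
  column inequalities between the rows \<open>i - 1\<close> and \<open>i\<close> of the new tableau, and the old column
  inequalities between the rows \<open>i\<close> and \<open>i + 1\<close> give the avoidance of row \<open>i + 1\<close> by the new row.
\<close>

lemma push_out_meets_above:
  assumes "is_partition lam k" "part lam 0 \<le> n" "d < part lam i" "p \<in> meets_below lam n i d"
  shows "push_out n i d p \<in> meets_above lam n i d"
proof -
  obtain R T where p: "p = (R, T)" by force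
  obtain R' T' where q: "push_out n i d p = (R', T')" by force
  have R': "R' (0, c) = (if c \<le> d then T (i, c) else R (0, c - 1))" if "c < Suc (n + i)" for c
    using q that by (auto simp: push_out_def p)
  have T': "T' (r, c) = (if r = i \<and> c \<le> d then (if c = 0 then undefined else R (0, c - 1)) else T (r, c))" for r c
    using q by (auto simp: push_out_def p)
  have anti: "part lam b \<le> part lam a" if "a \<le> b" for a b
    using part_antimono[OF assms(1) that] .
  have n: "part lam i \<le> n" using anti[of 0 i] assms(2) by simp
  have R: "R \<in> ssyt (skew_diagram [n + i] [])"
    and T: "T \<in> ssyt (cut_diagram lam i)"
    and at: "T (i, d) \<le> R (0, d)"
    and before: "\<And>e. e < d \<Longrightarrow> R (0, e) < T (i, e)"
    and free: "\<And>h e. i = Suc h \<Longrightarrow> e < d \<Longrightarrow> T (h, Suc e) < R (0, e)"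
    using assms(4) by (auto simp: meets_below_def tableau_pairs_def p)
  have Rmono: "R (0, a) \<le> R (0, b)" if "a \<le> b" "b < n + i" for a b
    using ssyt_row_mono[OF R that] .
  have Trow: "T (r, c) \<le> T (r, Suc c)" if "r < i \<longrightarrow> 0 < c" "Suc c < part lam r" for r c
    using T that by (auto simp: mem_ssyt_iff mem_cut_diagram_iff)
  have Tcol: "T (r, c) < T (Suc r, c)" if "r < i \<longrightarrow> 0 < c" "c < part lam (Suc r)" for r c
    using T that anti[of r "Suc r"]
    by (auto simp: mem_ssyt_iff mem_cut_diagram_iff)
  have "R' \<in> extensional (skew_diagram [n + Suc i] [])"
    using q by (auto simp: push_out_def p skew_diagram_row extensional_def)
  moreover have "R' (0, c) \<le> R' (0, Suc c)" if "Suc c < n + Suc i" for c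
  proof -
    consider "c < d" | "c = d" | "d < c" by linarith
    then show ?thesis
    proof cases
      case 1 then show ?thesis using Trow[of i c] that assms(3) by (simp add: R')
    next
      case 2 then show ?thesis using at that by (simp add: R')
    next
      case 3 then show ?thesis using Rmono[of "c - 1" c] that by (simp add: R')
    qed
  qed
  ultimately have R'_ssyt: "R' \<in> ssyt (skew_diagram [n + Suc i] [])"
    by (auto simp: mem_ssyt_iff skew_diagram_row)
  have "T' \<in> extensional (cut_diagram lam (Suc i))"
    using T assms(3) by (auto simp: extensional_def mem_ssyt_iff mem_cut_diagram_iff T'
       )
  moreover have "T' (r, c) \<le> T' (r, Suc c)" if "r < Suc i \<longrightarrow> 0 < c" "Suc c < part lam r" for r c
  proof -
    consider "r \<noteq> i" | "r = i" "c < d" | "r = i" "c = d" | "r = i" "d < c" by linarith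
    then show ?thesis
    proof cases
      case 1 then show ?thesis using Trow[of r c] that by (auto simp: T')
    next
      case 2 then show ?thesis using Rmono[of "c - 1" c] that n by (simp add: T')
    next
      case 3 then show ?thesis
        using before[of "c - 1"] Trow[of i "c - 1"] Trow[of i c] that by (simp add: T')
    next
      case 4 then show ?thesis using Trow[of r c] that by (simp add: T')
    qed
  qed
  moreover have "T' (r, c) < T' (Suc r, c)" if "r < Suc i \<longrightarrow> 0 < c" "c < part lam (Suc r)" for r c
  proof -
    consider "r = i" "c \<le> d" | "Suc r = i" "c \<le> d" | "r \<noteq> i" "Suc r \<noteq> i" | "d < c" by linarith
    then show ?thesis
    proof cases
      case 1
      then have "R (0, c - 1) < T (i, c - 1)" "T (i, c - 1) \<le> T (i, c)" "T (i, c) < T (Suc i, c)"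
        using before[of "c - 1"] Trow[of i "c - 1"] Tcol[of i c] that anti[of i "Suc i"] by auto
      with 1 show ?thesis using that by (simp add: T')
    next
      case 2 then show ?thesis using free[of r "c - 1"] that by (auto simp: T')
    next
      case 3 then show ?thesis using Tcol[of r c] that by (auto simp: T')
    next
      case 4 then show ?thesis using Tcol[of r c] that by (auto simp: T')
    qed
  qed
  ultimately have T'_ssyt: "T' \<in> ssyt (cut_diagram lam (Suc i))"
    by (auto simp: mem_ssyt_iff mem_cut_diagram_iff)
  have "R' (0, d) \<le> T' (i, Suc d)" if "Suc d < part lam i"
    using Trow[of i d] that n by (simp add: T' R')
  moreover have "T' (i, Suc e) < R' (0, e)" if "e < d" for e
    using before that assms(3) n by (simp add: T' R')
  moreover have "R' (0, e) < T' (Suc i, e)" if "e \<le> d" "e < part lam (Suc i)" for e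
    using Tcol[of i e] that assms(3) n by (simp add: T' R')
  ultimately show ?thesis
    using R'_ssyt T'_ssyt by (auto simp: q meets_above_def tableau_pairs_def)
qed

section \<open>Classification of the pairs\<close>

definition with_monomial :: "nat list \<Rightarrow> nat \<Rightarrow> nat \<Rightarrow> nat multiset \<Rightarrow> (filling \<times> filling) set \<Rightarrow> (filling \<times> filling) set" where
  "with_monomial lam n j M Q =
    {p \<in> Q. pair_monomial (skew_diagram [n + j] []) (cut_diagram lam j) p = M}"

lemma finite_with_monomial:
  assumes "Q \<subseteq> tableau_pairs lam n j"
  shows "finite (with_monomial lam n j M Q)"
  by (rule finite_subset[OF _ finite_pairs_of_monomial[OF finite_skew_diagram[of "[n + j]" "[]"]
      finite_cut_diagram[of lam j], of M]])
    (use assms in \<open>auto simp: with_monomial_def tableau_pairs_def\<close>)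

lemma card_meets_above_eq_meets_below:
  assumes "is_partition lam k" "part lam 0 \<le> n" "d < part lam i"
  shows "card (with_monomial lam n (Suc i) M (meets_above lam n i d))
    = card (with_monomial lam n i M (meets_below lam n i d))"
proof (rule bij_betw_same_card,
    rule bij_betw_byWitness[where f = "pull_in n i d" and f' = "push_out n i d"])
  have n: "part lam i \<le> n" using part_antimono[OF assms(1), of 0 i] assms(2) by simp
  have above: "meets_above lam n i d \<subseteq> tableau_pairs lam n (Suc i)"
    and below: "meets_below lam n i d \<subseteq> tableau_pairs lam n i"
    by (auto simp: meets_above_def meets_below_def)
  show "\<forall>p\<in>with_monomial lam n (Suc i) M (meets_above lam n i d). push_out n i d (pull_in n i d p) = p"
    using above push_out_pull_in[OF _ assms(3) n] by (auto simp: with_monomial_def)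
  show "\<forall>p\<in>with_monomial lam n i M (meets_below lam n i d). pull_in n i d (push_out n i d p) = p"
    using below pull_in_push_out[OF _ assms(3) n] by (auto simp: with_monomial_def)
  show "pull_in n i d ` with_monomial lam n (Suc i) M (meets_above lam n i d)
      \<subseteq> with_monomial lam n i M (meets_below lam n i d)"
    using pull_in_meets_below[OF assms] pair_monomial_pull_in[OF assms(3) n]
    by (auto simp: with_monomial_def)
  show "push_out n i d ` with_monomial lam n i M (meets_below lam n i d)
      \<subseteq> with_monomial lam n (Suc i) M (meets_above lam n i d)"
  proof
    fix q assume "q \<in> push_out n i d ` with_monomial lam n i M (meets_below lam n i d)"
    then obtain p where p: "p \<in> with_monomial lam n i M (meets_below lam n i d)"
      and q: "q = push_out n i d p" by auto
    then have "p \<in> meets_below lam n i d" by (simp add: with_monomial_def)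
    then have "q \<in> meets_above lam n i d" "pull_in n i d q = p"
      unfolding q using push_out_meets_above[OF assms] pull_in_push_out[OF subsetD[OF below] assms(3) n]
      by auto
    with p show "q \<in> with_monomial lam n (Suc i) M (meets_above lam n i d)"
      using pair_monomial_pull_in[OF assms(3) n, of q]
      by (auto simp: with_monomial_def)
  qed
qed

definition first_above :: "nat list \<Rightarrow> nat \<Rightarrow> nat \<Rightarrow> (filling \<times> filling) set" where
  "first_above lam n i = (\<Union>d<part lam i. meets_above lam n i d)"

definition first_below :: "nat list \<Rightarrow> nat \<Rightarrow> nat \<Rightarrow> (filling \<times> filling) set" where
  "first_below lam n i = (\<Union>d<part lam i. meets_below lam n i d)"

lemma meets_above_disjoint:
  assumes "d < d'" "d' < part lam i"
  shows "meets_above lam n i d \<inter> meets_above lam n i d' = {}"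
proof -
  have "R (0, d) \<le> T (i, Suc d)" "T (i, Suc d) < R (0, d)"
    if "(R, T) \<in> meets_above lam n i d" "(R, T) \<in> meets_above lam n i d'" for R T
    using that assms by (auto simp: meets_above_def)
  then show ?thesis by (force simp: not_less[symmetric])
qed

lemma meets_below_disjoint:
  assumes "d < d'"
  shows "meets_below lam n i d \<inter> meets_below lam n i d' = {}"
proof -
  have "T (i, d) \<le> R (0, d)" "R (0, d) < T (i, d)"
    if "(R, T) \<in> meets_below lam n i d" "(R, T) \<in> meets_below lam n i d'" for R T
    using that assms by (auto simp: meets_below_def)
  then show ?thesis by (force simp: not_less[symmetric])
qed

lemma card_first_above_eq_first_below:
  assumes "is_partition lam k" "part lam 0 \<le> n"
  shows "card (with_monomial lam n (Suc i) M (first_above lam n i))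
    = card (with_monomial lam n i M (first_below lam n i))"
proof -
  have UN: "with_monomial lam n j M (\<Union>d<m. F d) = (\<Union>d<m. with_monomial lam n j M (F d))" for j m F
    by (auto simp: with_monomial_def)
  have "card (with_monomial lam n (Suc i) M (first_above lam n i))
    = (\<Sum>d<part lam i. card (with_monomial lam n (Suc i) M (meets_above lam n i d)))"
    unfolding first_above_def UN
  proof (rule card_UN_disjoint)
    show "\<forall>d\<in>{..<part lam i}. finite (with_monomial lam n (Suc i) M (meets_above lam n i d))"
      by (intro ballI finite_with_monomial) (auto simp: meets_above_def)
    have "meets_above lam n i d \<inter> meets_above lam n i d' = {}"
      if "d < part lam i" "d' < part lam i" "d \<noteq> d'" for d d'
      using that meets_above_disjoint[of d d' lam i n] meets_above_disjoint[of d' d lam i n]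
      by (cases d d' rule: linorder_cases) auto
    then show "\<forall>d\<in>{..<part lam i}. \<forall>d'\<in>{..<part lam i}. d \<noteq> d' \<longrightarrow>
        with_monomial lam n (Suc i) M (meets_above lam n i d)
        \<inter> with_monomial lam n (Suc i) M (meets_above lam n i d') = {}"
      by (fastforce simp: with_monomial_def)
  qed simp
  also have "\<dots> = (\<Sum>d<part lam i. card (with_monomial lam n i M (meets_below lam n i d)))"
    by (intro sum.cong refl card_meets_above_eq_meets_below[OF assms]) simp
  also have "\<dots> = card (with_monomial lam n i M (first_below lam n i))"
    unfolding first_below_def UN
  proof (rule card_UN_disjoint[symmetric])
    show "\<forall>d\<in>{..<part lam i}. finite (with_monomial lam n i M (meets_below lam n i d))"
      by (intro ballI finite_with_monomial) (auto simp: meets_below_def)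
    have "meets_below lam n i d \<inter> meets_below lam n i d' = {}" if "d \<noteq> d'" for d d'
      using that meets_below_disjoint[of d d' lam n i] meets_below_disjoint[of d' d lam n i]
      by (cases d d' rule: linorder_cases) auto
    then show "\<forall>d\<in>{..<part lam i}. \<forall>d'\<in>{..<part lam i}. d \<noteq> d' \<longrightarrow>
        with_monomial lam n i M (meets_below lam n i d)
        \<inter> with_monomial lam n i M (meets_below lam n i d') = {}"
      by (fastforce simp: with_monomial_def)
  qed simp
  finally show ?thesis .
qed

lemma first_below_past_last_row: "first_below lam n (length lam) = {}"
  by (simp add: first_below_def part_def)

text \<open>
  Of two alleged first meetings, the earlier one contradicts the avoidance that the other class
  demands before its own meeting.
\<close>

lemma first_above_Int_first_below:
  assumes "is_partition lam k"
  shows "first_above lam n i \<inter> first_below lam n (Suc i) = {}"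
proof -
  have False if ab: "(R, T) \<in> meets_above lam n i a" "(R, T) \<in> meets_below lam n (Suc i) b"
    and lt: "b < part lam (Suc i)" for R T a b
  proof (cases "b \<le> a")
    case True
    then have "R (0, b) < T (Suc i, b)" "T (Suc i, b) \<le> R (0, b)"
      using ab lt by (auto simp: meets_above_def meets_below_def)
    then show False by simp
  next
    case False
    then have "Suc a < part lam i" using lt part_antimono[OF assms, of i "Suc i"] by simp
    then have "R (0, a) \<le> T (i, Suc a)" "T (i, Suc a) < R (0, a)"
      using ab False by (auto simp: meets_above_def meets_below_def)
    then show False by simp
  qed
  then show ?thesis by (auto simp: first_above_def first_below_def)
qed

text \<open>
  A first failure \<open>u\<close> to avoid row \<open>i\<close> always exists, at the latest at the end of that row. The pair
  belongs to the second class iff \<open>R\<close> fails to avoid row \<open>i + 1\<close> in a column \<open>e \<le> u\<close>. Equality counts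
  for row \<open>i + 1\<close>, since \<open>R (0, u)\<close> is compared with it on the vertical line before the step, and with
  row \<open>i\<close> on the line after the step.
\<close>

lemma first_above_Un_first_below:
  assumes "is_partition lam k" "i < length lam"
  shows "first_above lam n i \<union> first_below lam n (Suc i) = tableau_pairs lam n (Suc i)"
proof
  show "first_above lam n i \<union> first_below lam n (Suc i) \<subseteq> tableau_pairs lam n (Suc i)"
    by (auto simp: first_above_def first_below_def meets_above_def meets_below_def)
  show "tableau_pairs lam n (Suc i) \<subseteq> first_above lam n i \<union> first_below lam n (Suc i)"
  proof (rule subrelI)
    fix R T assume RT: "(R, T) \<in> tableau_pairs lam n (Suc i)"
    have "part lam i \<in> set lam" using assms(2) by (simp add: part_def)
    then have pos: "0 < part lam i"
      using assms(1) by (metis gr_zeroI is_partition_def)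
    define up where "up e \<longleftrightarrow> (Suc e < part lam i \<longrightarrow> R (0, e) \<le> T (i, Suc e))" for e
    define u where "u = (LEAST e. up e)"
    have ex: "up (part lam i - 1)" using pos by (simp add: up_def)
    have u: "up u" unfolding u_def using ex by (rule LeastI)
    have u_le: "u \<le> part lam i - 1" unfolding u_def using ex by (rule Least_le)
    have below_u: "T (i, Suc e) < R (0, e)" if "e < u" for e
      using not_less_Least[of e up] that by (simp add: u_def up_def)
    define down where "down e \<longleftrightarrow> e < part lam (Suc i) \<and> T (Suc i, e) \<le> R (0, e)" for e
    show "(R, T) \<in> first_above lam n i \<union> first_below lam n (Suc i)"
    proof (cases "\<exists>e\<le>u. down e")
      case False
      then have "(R, T) \<in> meets_above lam n i u"
        using u below_u RT by (auto simp: meets_above_def up_def down_def not_le)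
      then show ?thesis using u_le pos by (auto simp: first_above_def)
    next
      case True
      define d where "d = (LEAST e. down e)"
      have d: "down d" using True by (auto simp: d_def intro: LeastI)
      have "d \<le> u" using True by (auto simp: d_def intro: Least_le order_trans)
      moreover have "R (0, e) < T (Suc i, e)" if "e < d" for e
        using not_less_Least[of e down, folded d_def] that d by (auto simp: down_def)
      ultimately have "(R, T) \<in> meets_below lam n (Suc i) d"
        using d below_u RT by (auto simp: meets_below_def down_def)
      then show ?thesis using d by (auto simp: first_below_def down_def)
    qed
  qed
qed

section \<open>The pairs that form a tableau\<close>

text \<open>
  Only the inequalities between \<open>R\<close> and row 0 of \<open>T\<close> separate a pair for \<open>j = 0\<close> from a tableau of
  shape \<open>(n, \<lambda>)\<close>.
\<close>

definition stacked :: "nat list \<Rightarrow> nat \<Rightarrow> (filling \<times> filling) set" where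
  "stacked lam n = {(R, T) \<in> tableau_pairs lam n 0. \<forall>c<part lam 0. R (0, c) < T (0, c)}"

lemma stacked_Int_first_below: "stacked lam n \<inter> first_below lam n 0 = {}"
  by (fastforce simp: stacked_def first_below_def meets_below_def)

lemma stacked_Un_first_below: "stacked lam n \<union> first_below lam n 0 = tableau_pairs lam n 0"
proof
  show "stacked lam n \<union> first_below lam n 0 \<subseteq> tableau_pairs lam n 0"
    by (auto simp: stacked_def first_below_def meets_below_def)
  show "tableau_pairs lam n 0 \<subseteq> stacked lam n \<union> first_below lam n 0"
  proof (rule subrelI)
    fix R T assume RT: "(R, T) \<in> tableau_pairs lam n 0"
    define down where "down e \<longleftrightarrow> e < part lam 0 \<and> T (0, e) \<le> R (0, e)" for e
    show "(R, T) \<in> stacked lam n \<union> first_below lam n 0"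
    proof (cases "\<exists>e. down e")
      case False
      then show ?thesis using RT by (auto simp: stacked_def down_def not_le)
    next
      case True
      define d where "d = (LEAST e. down e)"
      have d: "down d" using True by (auto simp: d_def intro: LeastI)
      moreover have "R (0, e) < T (0, e)" if "e < d" for e
        using not_less_Least[of e down, folded d_def] that d by (auto simp: down_def)
      ultimately have "(R, T) \<in> meets_below lam n 0 d"
        using RT by (auto simp: meets_below_def down_def)
      then show ?thesis using d by (auto simp: first_below_def down_def)
    qed
  qed
qed

lemma part_Cons: "part (n # lam) i = (case i of 0 \<Rightarrow> n | Suc i \<Rightarrow> part lam i)"
  by (auto simp: part_def split: nat.split)

definition stack :: "filling \<times> filling \<Rightarrow> filling" where
  "stack = (\<lambda>(R, T) (r, c). case r of 0 \<Rightarrow> R (0, c) | Suc r \<Rightarrow> T (r, c))"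

definition unstack :: "filling \<Rightarrow> filling \<times> filling" where
  "unstack S = (\<lambda>(r, c). if r = 0 then S (0, c) else undefined, \<lambda>(r, c). S (Suc r, c))"

lemma unstack_stack:
  assumes "p \<in> tableau_pairs lam n 0"
  shows "unstack (stack p) = p"
  using assms
  by (cases p) (auto simp: stack_def unstack_def tableau_pairs_def mem_ssyt_iff extensional_def
      skew_diagram_row fun_eq_iff)

lemma stack_unstack: "stack (unstack S) = S"
  by (auto simp: stack_def unstack_def fun_eq_iff split: nat.splits)

lemma tableau_monomial_stack:
  "tableau_monomial (skew_diagram (n # lam) []) (stack p)
    = pair_monomial (skew_diagram [n + 0] []) (cut_diagram lam 0) p"
proof -
  obtain R T where p: "p = (R, T)" by force
  let ?shift = "\<lambda>(r, c). (Suc r, c)"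
  have D: "skew_diagram (n # lam) [] = {0} \<times> {..<n} \<union> ?shift ` skew_diagram lam []"
    by (auto simp: mem_skew_diagram_empty part_Cons image_iff Bex_def split: nat.splits)
  have "tableau_monomial (skew_diagram (n # lam) []) (stack p)
    = tableau_monomial ({0} \<times> {..<n}) (stack p)
      + tableau_monomial (?shift ` skew_diagram lam []) (stack p)"
    unfolding D by (rule tableau_monomial_Un_disjoint) (auto simp: finite_skew_diagram)
  also have "tableau_monomial ({0} \<times> {..<n}) (stack p) = tableau_monomial ({0} \<times> {..<n}) R"
    by (rule tableau_monomial_reindex[where f = id]) (auto simp: stack_def p)
  also have "tableau_monomial (?shift ` skew_diagram lam []) (stack p)
    = tableau_monomial (skew_diagram lam []) T"
    by (rule tableau_monomial_reindex[symmetric, where f = ?shift])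
      (auto simp: stack_def p bij_betw_def inj_on_def)
  finally show ?thesis by (simp add: pair_monomial_def skew_diagram_row cut_diagram_0 p)
qed

lemma stack_mem_ssyt_iff:
  assumes "part lam 0 \<le> n"
  shows "(R, T) \<in> stacked lam n \<longleftrightarrow>
    R \<in> extensional ({0} \<times> {..<n}) \<and> stack (R, T) \<in> ssyt (skew_diagram (n # lam) [])"
proof
  assume "(R, T) \<in> stacked lam n"
  then show "R \<in> extensional ({0} \<times> {..<n}) \<and> stack (R, T) \<in> ssyt (skew_diagram (n # lam) [])"
    by (auto simp: stacked_def stack_def tableau_pairs_def mem_ssyt_iff skew_diagram_row
        mem_skew_diagram_empty mem_cut_diagram_iff part_Cons extensional_def split: nat.splits)
next
  assume RS: "R \<in> extensional ({0} \<times> {..<n}) \<and> stack (R, T) \<in> ssyt (skew_diagram (n # lam) [])"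
  then have S: "stack (R, T) (r, c) = undefined" if "\<not> c < part (n # lam) r" for r c
    using that by (auto simp: mem_ssyt_iff extensional_def mem_skew_diagram_empty mem_cut_diagram_iff)
  have row: "stack (R, T) (r, c) \<le> stack (R, T) (r, Suc c)" if "Suc c < part (n # lam) r" for r c
    using RS that by (auto simp: mem_ssyt_iff mem_skew_diagram_empty mem_cut_diagram_iff)
  have col: "stack (R, T) (r, c) < stack (R, T) (Suc r, c)"
    if "c < part (n # lam) r" "c < part (n # lam) (Suc r)" for r c
    using RS that by (auto simp: mem_ssyt_iff mem_skew_diagram_empty mem_cut_diagram_iff)
  have "R \<in> ssyt (skew_diagram [n + 0] [])"
    using RS row[of _ 0] by (auto simp: mem_ssyt_iff skew_diagram_row stack_def part_Cons)
  moreover have "T \<in> ssyt (cut_diagram lam 0)"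
    using S[of _ "Suc _"] row[of _ "Suc _"] col[of _ "Suc _"]
    by (auto simp: mem_ssyt_iff mem_skew_diagram_empty mem_cut_diagram_iff extensional_def stack_def part_Cons)
  moreover have "R (0, c) < T (0, c)" if "c < part lam 0" for c
    using col[of c 0] that assms by (simp add: stack_def part_Cons)
  ultimately show "(R, T) \<in> stacked lam n" by (auto simp: stacked_def tableau_pairs_def)
qed

lemma card_stacked:
  assumes "part lam 0 \<le> n"
  shows "card (with_monomial lam n 0 M (stacked lam n)) =
    card {S \<in> ssyt (skew_diagram (n # lam) []). tableau_monomial (skew_diagram (n # lam) []) S = M}"
    (is "card ?P = card ?S")
proof (rule bij_betw_same_card, rule bij_betw_byWitness[where f = stack and f' = unstack])
  show "\<forall>p\<in>?P. unstack (stack p) = p"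
    by (auto simp: with_monomial_def stacked_def intro: unstack_stack)
  show "\<forall>S\<in>?S. stack (unstack S) = S" by (simp add: stack_unstack)
  show "stack ` ?P \<subseteq> ?S"
    using stack_mem_ssyt_iff[OF assms] tableau_monomial_stack[of n lam]
    by (auto simp: with_monomial_def)
  show "unstack ` ?S \<subseteq> ?P"
  proof
    fix p assume "p \<in> unstack ` ?S"
    then obtain S where S: "S \<in> ?S" and p: "p = unstack S" by auto
    obtain R T where RT: "unstack S = (R, T)" by force
    have "R \<in> extensional ({0} \<times> {..<n})"
      using S RT by (auto simp: unstack_def mem_ssyt_iff extensional_def mem_skew_diagram_empty mem_cut_diagram_iff part_Cons)
    moreover have "stack (R, T) = S" using stack_unstack[of S] by (simp add: RT)
    ultimately show "p \<in> ?P"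
      using S stack_mem_ssyt_iff[OF assms, of R T] tableau_monomial_stack[of n lam "(R, T)"]
      by (auto simp: with_monomial_def p RT)
  qed
qed

section \<open>The alternating sum\<close>

lemma card_with_monomial_Un:
  assumes "A \<union> B = tableau_pairs lam n j" "A \<inter> B = {}"
  shows "card (with_monomial lam n j M (tableau_pairs lam n j))
    = card (with_monomial lam n j M A) + card (with_monomial lam n j M B)"
proof -
  have "with_monomial lam n j M (tableau_pairs lam n j)
      = with_monomial lam n j M A \<union> with_monomial lam n j M B"
    by (auto simp: with_monomial_def assms(1)[symmetric])
  moreover have "finite (with_monomial lam n j M A)" "finite (with_monomial lam n j M B)"
    using assms(1) by (auto intro: finite_with_monomial)
  moreover have "with_monomial lam n j M A \<inter> with_monomial lam n j M B = {}"
    using assms(2) by (auto simp: with_monomial_def)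
  ultimately show ?thesis by (simp add: card_Un_disjoint)
qed

lemma alternating_sum_telescope:
  fixes f :: "nat \<Rightarrow> 'a::comm_ring_1"
  shows "(\<Sum>j = 0..t. (- 1) ^ j * (f j + f (Suc j))) = f 0 + (- 1) ^ t * f (Suc t)"
  by (induction t) (simp_all add: algebra_simps)

theorem theorem2p1:
  fixes lam :: "nat list" and k n :: nat
  assumes "is_partition lam k"
    and "part lam 0 \<le> n"
  shows "schur (n # lam)
    = (\<Sum>j = 0..length lam. (-1) ^ j * schur [n + j] * skew_schur lam (replicate j 1))"
proof (rule mfps_eqI)
  fix M
  let ?card = "\<lambda>j Q. int (card (with_monomial lam n j M Q))"
  \<comment> \<open>The pairs for \<open>j\<close> split into \<open>f j\<close> pairs that meet the row above and \<open>f (j + 1)\<close> pairs that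
      meet the row below; the tableaux of shape \<open>(n, \<lambda>)\<close> take the place of the former for \<open>j = 0\<close>.\<close>
  define f where "f j = (case j of 0 \<Rightarrow> ?card 0 (stacked lam n) | Suc i \<Rightarrow> ?card i (first_below lam n i))"
    for j
  have pairs: "?card j (tableau_pairs lam n j) = f j + f (Suc j)" if "j \<le> length lam" for j
  proof (cases j)
    case 0
    then show ?thesis
      using card_with_monomial_Un[OF stacked_Un_first_below stacked_Int_first_below]
      by (simp add: f_def)
  next
    case (Suc i)
    then show ?thesis
      using that card_with_monomial_Un[OF first_above_Un_first_below[OF assms(1), of i n]
          first_above_Int_first_below[OF assms(1)]] card_first_above_eq_first_below[OF assms]
      by (simp add: f_def)
  qed
  have coeff: "mcoeff (schur [n + j] * skew_schur lam (replicate j 1)) M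
      = ?card j (tableau_pairs lam n j)" for j
    unfolding schur_def mcoeff_skew_schur_mult with_monomial_def tableau_pairs_def cut_diagram_def ..
  have "mcoeff (\<Sum>j = 0..length lam. (-1) ^ j * schur [n + j] * skew_schur lam (replicate j 1)) M
      = (\<Sum>j = 0..length lam. (-1) ^ j * (f j + f (Suc j)))"
    unfolding mcoeff_sum mult.assoc mcoeff_minus_one_power_mult coeff
    by (intro sum.cong refl) (simp add: pairs)
  also have "\<dots> = f 0"
    unfolding alternating_sum_telescope
    by (simp add: f_def first_below_past_last_row with_monomial_def)
  also have "\<dots> = mcoeff (schur (n # lam)) M"
    by (simp add: f_def card_stacked[OF assms(2)] schur_def skew_schur_def)
  finally show "mcoeff (schur (n # lam)) M
      = mcoeff (\<Sum>j = 0..length lam. (-1) ^ j * schur [n + j] * skew_schur lam (replicate j 1)) M"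
    by simp
qed

end
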